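(* Let $A,B,C\in\mathbb{R}^{n\times n}$ be nonzero, let $\mathcal{Q}=I_{n^2}-(B^\top\otimes A)\mathcal{P}$ and assume $\mathcal{Q}$ is nonsingular. Let $X$ be the solution of $X=AX^\top B+C$. Let $\delta A,\delta B,\delta C\in\mathbb{R}^{n\times n}$ and let $\delta X\in\mathbb{R}^{n\times n}$ satisfy the first-order perturbation equation $$\delta X-A\,\delta X^\top B=AX^\top\delta B+\delta A\,X^\top B+\delta C.$$ With $\alpha=\|A\|_F$, $\beta=\|B\|_F$, $\gamma=\|C\|_F$ and $\zeta=\max\{\|\delta A\|_F/\|A\|_F,\ \|\delta B\|_F/\|B\|_F,\ \|\delta C\|_F/\|C\|_F\}$, one has $$\frac{\|\delta X\|_F}{\|X\|_F}\le\sqrt{3}\,\Psi\,\zeta,\qquad \Psi=\frac{\bigl\|\mathcal{Q}^{-1}\begin{bmatrix}\alpha (X^\top B)^\top\otimes I_n & \beta I_n\otimes(AX^\top) & \gamma I_{n^2}\end{bmatrix}\bigr\|_2}{\|X\|_F}.$$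
   Context: $\otimes$ is the Kronecker product, $\|\cdot\|_F$ the Frobenius norm, $\|\cdot\|_2$ the spectral norm. $\mathcal{P}=\sum_{1\le i,j\le n}e_je_i^\top\otimes e_ie_j^\top$ is the $n^2\times n^2$ Kronecker permutation matrix, which satisfies $\mathcal{P}\,\mathrm{vec}(Z)=\mathrm{vec}(Z^\top)$ for $Z\in\mathbb{R}^{n\times n}$, where $e_i$ is the $i$-th column of $I_n$ and $\mathrm{vec}$ stacks the columns of a matrix into a vector. The first-order perturbation equation is obtained from $X+\delta X=(A+\delta A)(X+\delta X)^\top(B+\delta B)+(C+\delta C)$ by dropping the terms of higher order in the perturbations. *)

theory Defs
  imports "HOL-Analysis.Analysis"
begin

text \<open>
  Indices of Kronecker products are pairs (block index, index within the block),
  and \<open>vec Z\<close> uses the same convention: the entry at \<open>(j, i)\<close> is the \<open>i\<close>-th entry of column \<open>j\<close>.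
\<close>

definition kron :: "real^'b^'a \<Rightarrow> real^'d^'c \<Rightarrow> real^('b \<times> 'd)^('a \<times> 'c)"
    (infixr "\<otimes>\<^sub>K" 75)
  where "A \<otimes>\<^sub>K B = (\<chi> r s. A $ fst r $ fst s * B $ snd r $ snd s)"

definition vec_cols :: "real^'n^'m \<Rightarrow> real^('n \<times> 'm)"
  where "vec_cols Z = (\<chi> r. Z $ snd r $ fst r)"

definition unit_col :: "'n::finite \<Rightarrow> real^1^'n"
  where "unit_col i = columnvector (column i (mat 1))"

definition kron_perm :: "real^('n::finite \<times> 'n)^('n \<times> 'n)"
  where "kron_perm =
    (\<Sum>i\<in>UNIV. \<Sum>j\<in>UNIV.
      (unit_col j ** transpose (unit_col i)) \<otimes>\<^sub>K (unit_col i ** transpose (unit_col j)))"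

definition frob_norm :: "real^'n^'m \<Rightarrow> real"
  where "frob_norm A = sqrt (\<Sum>i\<in>UNIV. \<Sum>j\<in>UNIV. (A $ i $ j)\<^sup>2)"

definition spectral_norm :: "real^'n^'m \<Rightarrow> real"
  where "spectral_norm A = onorm ((*v) A)"

definition hcat :: "real^'a^'m \<Rightarrow> real^'b^'m \<Rightarrow> real^('a + 'b)^'m"  (infixr "|||" 60)
  where "A ||| B = (\<chi> i s. case s of Inl j \<Rightarrow> A $ i $ j | Inr j \<Rightarrow> B $ i $ j)"

lemma frob_norm_eq_norm: "frob_norm A = norm A"
  by (simp add: frob_norm_def norm_vec_def L2_set_def sum_nonneg)

lemma kron_perm_nth:
  fixes r s :: "'n::finite \<times> 'n"
  shows "kron_perm $ r $ s = (if fst r = snd s \<and> snd r = fst s then 1 else 0)"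
proof -
  have [simp]: "(unit_col i ** transpose (unit_col j)) $ a $ b =
      (if a = i then 1 else 0) * (if b = j then 1 else 0)" for i j a b :: 'n
    by (auto simp: unit_col_def columnvector_def column_def transpose_def matrix_matrix_mult_def mat_def)
  have "kron_perm $ r $ s = (\<Sum>i\<in>UNIV. \<Sum>j\<in>UNIV.
      ((unit_col j ** transpose (unit_col i)) \<otimes>\<^sub>K
        (unit_col i ** transpose (unit_col j))) $ r $ s)"
    by (simp add: kron_perm_def)
  also have "\<dots> =
      (\<Sum>i\<in>UNIV. \<Sum>j\<in>UNIV. if j = fst r then
         (if i = fst s \<and> i = snd r \<and> j = snd s then 1 else 0) else 0)"
    by (intro sum.cong refl) (auto simp: kron_def)
  also have "\<dots> = (\<Sum>i\<in>UNIV. if i = fst s then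
      (if fst s = snd r \<and> fst r = snd s then 1 else 0) else 0)"
    by (intro sum.cong) (auto simp: sum.delta)
  also have "\<dots> = (if fst r = snd s \<and> snd r = fst s then 1 else 0)"
    by (auto simp: sum.delta)
  finally show ?thesis .
qed

lemma kron_perm_vec:
  fixes Z :: "real^'n^'n"
  shows "kron_perm *v vec_cols Z = vec_cols (transpose Z)"
proof -
  have "(\<Sum>s\<in>UNIV. kron_perm $ r $ s * vec_cols Z $ s) = Z $ fst r $ snd r" for r :: "'n \<times> 'n"
  proof -
    have "(\<Sum>s\<in>UNIV. kron_perm $ r $ s * vec_cols Z $ s)
        = (\<Sum>s\<in>UNIV. if s = (snd r, fst r) then vec_cols Z $ s else 0)"
      by (intro sum.cong) (auto simp: kron_perm_nth)
    then show ?thesis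
      by (simp add: sum.delta vec_cols_def)
  qed
  then show ?thesis
    by (simp add: vec_eq_iff matrix_vector_mult_def) (simp add: vec_cols_def transpose_def)
qed

lemma vec_cols_triple_product:
  "vec_cols (A ** Z ** B) = (transpose B \<otimes>\<^sub>K A) *v vec_cols Z"
proof -
  have "(\<Sum>l\<in>UNIV. (\<Sum>k\<in>UNIV. A $ snd r $ k * Z $ k $ l) * B $ l $ fst r)
      = (\<Sum>s\<in>UNIV \<times> UNIV. B $ fst s $ fst r * A $ snd r $ snd s * Z $ snd s $ fst s)" for r
    unfolding sum_distrib_right sum.cartesian_product case_prod_unfold
    by (simp add: mult_ac)
  then show ?thesis
    by (simp add: vec_eq_iff vec_cols_def kron_def matrix_vector_mult_def
        matrix_matrix_mult_def transpose_def)
qed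

end

theory Submission
  imports Defs
begin

text \<open>
  Vectorising the first-order equation turns its left-hand side into \<open>Q *v vec_cols \<delta>X\<close>, because
  \<open>kron_perm\<close> implements transposition and \<open>transpose B \<otimes>\<^sub>K A\<close> implements \<open>Z \<mapsto> A ** Z ** B\<close>.
  Its right-hand side is linear in the three perturbations and equals \<open>M *v w\<close>, where \<open>M\<close> is the
  block row in the definition of \<open>\<Psi>\<close> and \<open>w\<close> stacks the relative perturbations
  \<open>vec_cols \<delta>A / \<alpha>\<close>, \<open>vec_cols \<delta>B / \<beta>\<close> and \<open>vec_cols \<delta>C / \<gamma>\<close>; the weights \<open>\<alpha>\<close>, \<open>\<beta>\<close>, \<open>\<gamma>\<close> in the
  blocks of \<open>M\<close> cancel these denominators (\<open>vec_cols_first_order_rhs\<close>).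

  Hence \<open>vec_cols \<delta>X = (matrix_inv Q ** M) *v w\<close>. Each of the three parts of \<open>w\<close> has norm at most
  \<open>\<zeta>\<close>, so Pythagoras gives \<open>norm w \<le> sqrt 3 * \<zeta>\<close>, which is where the factor \<open>sqrt 3\<close> comes from
  (\<open>norm_vcat3_le\<close>). Vectorisation is an isometry from the Frobenius to the Euclidean norm, and the
  spectral norm is the operator norm, so the bound follows after division by \<open>frob_norm X\<close>,
  which is positive because \<open>X = 0\<close> would force \<open>C = 0\<close>.
\<close>

definition vcat :: "real^'a \<Rightarrow> real^'b \<Rightarrow> real^('a + 'b)"
  where "vcat u v = (\<chi> s. case s of Inl i \<Rightarrow> u $ i | Inr j \<Rightarrow> v $ j)"

lemma sum_UNIV_Plus:
  fixes f :: "'a::finite + 'b::finite \<Rightarrow> 'c::comm_monoid_add"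
  shows "sum f UNIV = (\<Sum>i\<in>UNIV. f (Inl i)) + (\<Sum>j\<in>UNIV. f (Inr j))"
  by (simp add: UNIV_Plus_UNIV [symmetric] sum.Plus del: UNIV_Plus_UNIV)

lemma hcat_mult_vcat: "(A ||| B) *v vcat u v = A *v u + B *v v"
  by (simp add: vec_eq_iff matrix_vector_mult_def hcat_def vcat_def sum_UNIV_Plus)

lemma norm_vcat_sq: "(norm (vcat u v))\<^sup>2 = (norm u)\<^sup>2 + (norm v)\<^sup>2"
  by (simp add: norm_vec_def L2_set_def sum_nonneg vcat_def sum_UNIV_Plus)

lemma norm_vcat3_le:
  assumes "norm u \<le> z" "norm v \<le> z" "norm w \<le> z"
  shows "norm (vcat u (vcat v w)) \<le> sqrt 3 * z"
proof -
  have "(norm u)\<^sup>2 \<le> z\<^sup>2" "(norm v)\<^sup>2 \<le> z\<^sup>2" "(norm w)\<^sup>2 \<le> z\<^sup>2"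
    using assms by (simp_all add: power_mono)
  then have "(norm (vcat u (vcat v w)))\<^sup>2 \<le> (sqrt 3 * z)\<^sup>2"
    by (simp add: norm_vcat_sq power_mult_distrib)
  moreover have "0 \<le> z"
    using assms(1) norm_ge_zero order_trans by blast
  ultimately show ?thesis
    by (meson power2_le_imp_le mult_nonneg_nonneg real_sqrt_ge_zero zero_le_numeral)
qed

lemma norm_vec_cols: "norm (vec_cols Z) = frob_norm Z"
proof -
  have "(\<Sum>r\<in>UNIV. (Z $ snd r $ fst r)\<^sup>2) = (\<Sum>j\<in>UNIV. \<Sum>i\<in>UNIV. (Z $ i $ j)\<^sup>2)"
    by (simp add: sum.cartesian_product case_prod_unfold)
  also have "\<dots> = (\<Sum>i\<in>UNIV. \<Sum>j\<in>UNIV. (Z $ i $ j)\<^sup>2)"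
    by (rule sum.swap)
  finally show ?thesis
    by (simp add: norm_vec_def L2_set_def vec_cols_def frob_norm_def)
qed

lemma vec_cols_add: "vec_cols (Y + Z) = vec_cols Y + vec_cols Z"
  by (simp add: vec_eq_iff vec_cols_def)

lemma vec_cols_diff: "vec_cols (Y - Z) = vec_cols Y - vec_cols Z"
  by (simp add: vec_eq_iff vec_cols_def)

lemma norm_matrix_vector_mult_le_spectral: "norm (M *v v) \<le> spectral_norm M * norm v"
  by (simp add: spectral_norm_def onorm)

lemma matrix_inv_mult_left:
  fixes M :: "'a::semiring_1^'n^'m"
  assumes "invertible M"
  shows "matrix_inv M ** M = mat 1"
  using assms unfolding invertible_def matrix_inv_def by (rule someI2_ex) simp

lemma vec_cols_first_order_lhs:
  fixes A B Z :: "real^'n^'n"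
  shows "(mat 1 - (transpose B \<otimes>\<^sub>K A) ** kron_perm) *v vec_cols Z
    = vec_cols (Z - A ** transpose Z ** B)"
  by (simp add: matrix_vector_mult_diff_rdistrib kron_perm_vec vec_cols_triple_product
      vec_cols_diff flip: matrix_vector_mul_assoc)

text \<open>
  The two products are triple products with an identity factor on one side, which is why an
  identity appears as one Kronecker factor of each block. The nonzero weights on the blocks and
  on the parts of the vector cancel.
\<close>

lemma vec_cols_first_order_rhs:
  fixes D E F G H :: "real^'n^'n"
  assumes "a \<noteq> 0" "b \<noteq> 0" "c \<noteq> 0"
  shows "(a *\<^sub>R (transpose H \<otimes>\<^sub>K (mat 1 :: real^'n^'n))
        ||| b *\<^sub>R ((mat 1 :: real^'n^'n) \<otimes>\<^sub>K G)
        ||| c *\<^sub>R (mat 1 :: real^('n \<times> 'n)^('n \<times> 'n)))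
      *v vcat (vec_cols D /\<^sub>R a) (vcat (vec_cols E /\<^sub>R b) (vec_cols F /\<^sub>R c))
    = vec_cols (G ** E + D ** H + F)"
proof -
  have "vec_cols (D ** H) = (transpose H \<otimes>\<^sub>K mat 1) *v vec_cols D"
    using vec_cols_triple_product [of "mat 1" D H] by simp
  moreover have "vec_cols (G ** E) = (mat 1 \<otimes>\<^sub>K G) *v vec_cols E"
    using vec_cols_triple_product [of G E "mat 1"] by simp
  ultimately show ?thesis
    using assms
    by (simp add: hcat_mult_vcat vec_cols_add matrix_vector_mult_scaleR
        flip: scaleR_matrix_vector_assoc)
qed

theorem mainTheorem5:
  fixes A B C X \<delta>A \<delta>B \<delta>C \<delta>X :: "real^'n^'n"
    and Q :: "real^('n \<times> 'n)^('n \<times> 'n)"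
    and \<alpha> \<beta> \<gamma> \<zeta> \<Psi> :: real
  assumes nonzero: "A \<noteq> 0" "B \<noteq> 0" "C \<noteq> 0"
    and Q: "Q = mat 1 - (transpose B \<otimes>\<^sub>K A) ** kron_perm"
    and Q_nonsingular: "invertible Q"
    and X: "X = A ** transpose X ** B + C"
    and \<delta>X: "\<delta>X - A ** transpose \<delta>X ** B
              = A ** transpose X ** \<delta>B + \<delta>A ** transpose X ** B + \<delta>C"
    and \<alpha>: "\<alpha> = frob_norm A"
    and \<beta>: "\<beta> = frob_norm B"
    and \<gamma>: "\<gamma> = frob_norm C"
    and \<zeta>: "\<zeta> = Max {frob_norm \<delta>A / frob_norm A, frob_norm \<delta>B / frob_norm B,
                    frob_norm \<delta>C / frob_norm C}"
    and \<Psi>: "\<Psi> = spectral_norm (matrix_inv Q **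
                 (\<alpha> *\<^sub>R (transpose (transpose X ** B) \<otimes>\<^sub>K (mat 1 :: real^'n^'n))
                  ||| \<beta> *\<^sub>R ((mat 1 :: real^'n^'n) \<otimes>\<^sub>K (A ** transpose X))
                  ||| \<gamma> *\<^sub>R (mat 1 :: real^('n \<times> 'n)^('n \<times> 'n)))) / frob_norm X"
  shows "frob_norm \<delta>X / frob_norm X \<le> sqrt 3 * \<Psi> * \<zeta>"
proof -
  let ?M = "\<alpha> *\<^sub>R (transpose (transpose X ** B) \<otimes>\<^sub>K (mat 1 :: real^'n^'n))
    ||| \<beta> *\<^sub>R ((mat 1 :: real^'n^'n) \<otimes>\<^sub>K (A ** transpose X))
    ||| \<gamma> *\<^sub>R (mat 1 :: real^('n \<times> 'n)^('n \<times> 'n))"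
  let ?w = "vcat (vec_cols \<delta>A /\<^sub>R \<alpha>) (vcat (vec_cols \<delta>B /\<^sub>R \<beta>) (vec_cols \<delta>C /\<^sub>R \<gamma>))"
  have pos: "\<alpha> > 0" "\<beta> > 0" "\<gamma> > 0"
    using nonzero by (simp_all add: \<alpha> \<beta> \<gamma> frob_norm_eq_norm)
  have "X \<noteq> 0"
  proof
    assume "X = 0"
    moreover have "A ** transpose (0 :: real^'n^'n) ** B = 0"
      by (simp add: transpose_def matrix_matrix_mult_def vec_eq_iff)
    ultimately have "C = 0"
      using X by (metis add_0)
    with nonzero(3) show False ..
  qed
  then have X_pos: "frob_norm X > 0"
    by (simp add: frob_norm_eq_norm)
  have "Q *v vec_cols \<delta>X = vec_cols (A ** transpose X ** \<delta>B + \<delta>A ** transpose X ** B + \<delta>C)"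
    by (simp add: Q vec_cols_first_order_lhs \<delta>X)
  also have "\<dots> = ?M *v ?w"
    using pos by (simp add: vec_cols_first_order_rhs matrix_mul_assoc)
  finally have Q_vec: "Q *v vec_cols \<delta>X = ?M *v ?w" .
  have "vec_cols \<delta>X = matrix_inv Q *v (Q *v vec_cols \<delta>X)"
    using Q_nonsingular by (simp add: matrix_vector_mul_assoc matrix_inv_mult_left)
  also have "\<dots> = (matrix_inv Q ** ?M) *v ?w"
    by (simp only: Q_vec matrix_vector_mul_assoc)
  finally have sol: "vec_cols \<delta>X = (matrix_inv Q ** ?M) *v ?w" .
  have "norm (vec_cols \<delta>A /\<^sub>R \<alpha>) \<le> \<zeta>" "norm (vec_cols \<delta>B /\<^sub>R \<beta>) \<le> \<zeta>"
    "norm (vec_cols \<delta>C /\<^sub>R \<gamma>) \<le> \<zeta>"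
    using pos unfolding \<zeta> \<alpha> \<beta> \<gamma> by (simp_all add: norm_vec_cols divide_inverse_commute)
  then have w_le: "norm ?w \<le> sqrt 3 * \<zeta>"
    by (rule norm_vcat3_le)
  have "frob_norm \<delta>X \<le> spectral_norm (matrix_inv Q ** ?M) * norm ?w"
    using norm_matrix_vector_mult_le_spectral sol norm_vec_cols by metis
  also have "\<dots> \<le> spectral_norm (matrix_inv Q ** ?M) * (sqrt 3 * \<zeta>)"
    using w_le by (intro mult_left_mono)
      (simp_all add: spectral_norm_def onorm_pos_le)
  finally show ?thesis
    using X_pos by (simp add: \<Psi> divide_right_mono mult_ac)
qed

end
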